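(* There exist a finite-horizon Markov decision model $(\{\mathcal{S}_t\}_{t=1}^T,\{\mathcal{A}_t\}_{t=1}^T,\{c_t\}_{t=1}^T)$, an initial state $s_1\in\mathcal{S}_1$, and an ambiguity set $\mathcal{P}=\{P_{(1)},P_{(2)}\}$ of two distinct transition kernels such that the problem $$\min_{\pi\in\Pi_{\mathrm{MR}}} V^\pi_r(s_1),\qquad V^\pi_r(s_1)=\max\left\{V^{\pi}_{P_{(1)}}(s_1),\,V^{\pi}_{P_{(2)}}(s_1)\right\},$$ over the set $\Pi_{\mathrm{MR}}$ of randomized Markovian policies has a sub-optimal strict local minimizer; that is, there exist $\pi\in\Pi_{\mathrm{MR}}$, $\delta>0$ and $\pi^*\in\Pi_{\mathrm{MR}}$ such that $$V^{\pi^*}_r(s_1)<V^{\pi}_r(s_1)<V^{\pi'}_r(s_1)\quad\text{for all }\pi'\in\Pi_{\mathrm{MR}}\text{ with }\pi'\neq\pi\text{ and }\|\pi'-\pi\|\le\delta.$$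
   Context: Model. $T\ge 1$ is a finite horizon; $\mathcal{S}_t$ and $\mathcal{A}_t$ are the finite state and action spaces at stage $t$; $c_t:\mathcal{S}_t\times\mathcal{A}_t\to\mathbb{R}\cup\{+\infty\}$ is the cost function at stage $t$. The value $c_t(s,a)=+\infty$ only serves to indicate that action $a$ is not available at state $s$; policies use only available actions, and each state has at least one available action. If $\mathcal{A}_t=\emptyset$ (no action to be chosen), this means that costs and transitions at that stage depend on the state only, equivalently that there is a single dummy action. A transition kernel $P$ specifies, for each $1\le t\le T-1$, $s\in\mathcal{S}_t$ and $a\in\mathcal{A}_t$, a probability distribution $P(S_{t+1}=\cdot\mid S_t=s,A_t=a)$ on $\mathcal{S}_{t+1}$. Policies. A randomized Markovian policy $\pi\in\Pi_{\mathrm{MR}}$ assigns to each stage $t$ and each $s\in\mathcal{S}_t$ a probability distribution $\pi_t(\cdot\mid s)$ on $\mathcal{A}_t$ supported on the actions available at $s$. The distance between policies is $\|\pi'-\pi\|=\sup_t\sup_{s_t\in\mathcal{S}_t}\|\pi_t(\cdot\mid s_t)-\pi'_t(\cdot\mid s_t)\|$, where the norm on the right is the Euclidean norm. Value. For a policy $\pi$, a kernel $P$ and an initial state $s_1$, $$V^\pi_P(s_1)=\mathbb{E}^{\pi,P}\left[\sum_{t=1}^T c_t(S_t,A_t)\,\Big|\,S_1=s_1\right],$$ where the expectation is with respect to the law of the process $\{(S_t,A_t)\}_{t=1}^T$ induced by $(\pi,P)$. *)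

theory Defs
  imports "HOL-Probability.Probability"
begin

record ('s, 'a) mdp =
  horizon :: nat
  states  :: "nat \<Rightarrow> 's set"
  actions :: "nat \<Rightarrow> 'a set"
  cost    :: "nat \<Rightarrow> 's \<Rightarrow> 'a \<Rightarrow> ereal"

text \<open>
  The cost \<^term>\<open>\<infinity>\<close> marks an unavailable action; \<^term>\<open>-\<infinity>\<close> is not a cost.
  A stage without a decision has a single dummy action.
\<close>

definition available :: "('s, 'a) mdp \<Rightarrow> nat \<Rightarrow> 's \<Rightarrow> 'a set" where
  "available M t s = {a \<in> actions M t. cost M t s a \<noteq> \<infinity>}"

definition valid_mdp :: "('s, 'a) mdp \<Rightarrow> bool" where
  "valid_mdp M \<longleftrightarrow>
     1 \<le> horizon M \<and>
     (\<forall>t\<in>{1..horizon M}.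
        finite (states M t) \<and> states M t \<noteq> {} \<and> finite (actions M t) \<and>
        (\<forall>s\<in>states M t. available M t s \<noteq> {} \<and>
           (\<forall>a\<in>actions M t. cost M t s a \<noteq> -\<infinity>)))"

text \<open>
  Kernels and policies are extensional functions, so that inequality of two of them means
  that they differ at some stage and state (and action) of the model.
\<close>

definition kernels :: "('s, 'a) mdp \<Rightarrow> (nat \<Rightarrow> 's \<Rightarrow> 'a \<Rightarrow> 's pmf) set" where
  "kernels M =
     (\<Pi>\<^sub>E t\<in>{1..<horizon M}. \<Pi>\<^sub>E s\<in>states M t. \<Pi>\<^sub>E a\<in>actions M t.
        {p. set_pmf p \<subseteq> states M (Suc t)})"

definition policies_MR :: "('s, 'a) mdp \<Rightarrow> (nat \<Rightarrow> 's \<Rightarrow> 'a pmf) set" where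
  "policies_MR M =
     (\<Pi>\<^sub>E t\<in>{1..horizon M}. \<Pi>\<^sub>E s\<in>states M t. {p. set_pmf p \<subseteq> available M t s})"

definition policy_dist ::
  "('s, 'a) mdp \<Rightarrow> (nat \<Rightarrow> 's \<Rightarrow> 'a pmf) \<Rightarrow> (nat \<Rightarrow> 's \<Rightarrow> 'a pmf) \<Rightarrow> real" where
  "policy_dist M \<pi>' \<pi> =
     (SUP t\<in>{1..horizon M}. SUP s\<in>states M t.
        L2_set (\<lambda>a. pmf (\<pi> t s) a - pmf (\<pi>' t s) a) (actions M t))"

text \<open>
  \<open>history_law \<pi> P s1 t\<close> is the law of \<open>(S_1, A_1), ..., (S_t, A_t)\<close> given \<open>S_1 = s1\<close>;
  the pair of stage \<open>t\<close> is at list position \<open>t - 1\<close>.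
\<close>

primrec history_law ::
  "(nat \<Rightarrow> 's \<Rightarrow> 'a pmf) \<Rightarrow> (nat \<Rightarrow> 's \<Rightarrow> 'a \<Rightarrow> 's pmf) \<Rightarrow> 's \<Rightarrow> nat \<Rightarrow> ('s \<times> 'a) list pmf"
where
  "history_law \<pi> P s1 0 = return_pmf []"
| "history_law \<pi> P s1 (Suc t) =
     bind_pmf (history_law \<pi> P s1 t) (\<lambda>h.
     bind_pmf (if t = 0 then return_pmf s1 else P t (fst (last h)) (snd (last h))) (\<lambda>s.
     bind_pmf (\<pi> (Suc t) s) (\<lambda>a.
     return_pmf (h @ [(s, a)]))))"

text \<open>
  The conversion \<^term>\<open>real_of_ereal\<close> loses nothing: the costs incurred under a policy are
  finite almost surely, see \<open>history_law_cost_finite\<close> below.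
\<close>

definition policy_value ::
  "('s, 'a) mdp \<Rightarrow> (nat \<Rightarrow> 's \<Rightarrow> 'a \<Rightarrow> 's pmf) \<Rightarrow> (nat \<Rightarrow> 's \<Rightarrow> 'a pmf) \<Rightarrow> 's \<Rightarrow> real" where
  "policy_value M P \<pi> s1 =
     measure_pmf.expectation (history_law \<pi> P s1 (horizon M))
       (\<lambda>h. \<Sum>t = 1..horizon M.
          real_of_ereal (cost M t (fst (h ! (t - 1))) (snd (h ! (t - 1)))))"

definition robust_value ::
  "('s, 'a) mdp \<Rightarrow> (nat \<Rightarrow> 's \<Rightarrow> 'a \<Rightarrow> 's pmf) \<Rightarrow> (nat \<Rightarrow> 's \<Rightarrow> 'a \<Rightarrow> 's pmf)
     \<Rightarrow> (nat \<Rightarrow> 's \<Rightarrow> 'a pmf) \<Rightarrow> 's \<Rightarrow> real" where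
  "robust_value M P1 P2 \<pi> s1 = max (policy_value M P1 \<pi> s1) (policy_value M P2 \<pi> s1)"

lemma history_law_available:
  assumes "\<pi> \<in> policies_MR M" "P \<in> kernels M" "s1 \<in> states M 1"
  assumes "t \<le> horizon M" "h \<in> set_pmf (history_law \<pi> P s1 t)"
  shows "length h = t \<and> (\<forall>i<t. fst (h ! i) \<in> states M (Suc i) \<and>
           snd (h ! i) \<in> available M (Suc i) (fst (h ! i)))"
  using assms(4,5)
proof (induction t arbitrary: h)
  case 0
  then show ?case by simp
next
  case (Suc t)
  from Suc.prems(2) obtain g s a where
    g: "g \<in> set_pmf (history_law \<pi> P s1 t)" and
    s: "s \<in> set_pmf (if t = 0 then return_pmf s1 else P t (fst (last g)) (snd (last g)))" and
    a: "a \<in> set_pmf (\<pi> (Suc t) s)" and h: "h = g @ [(s, a)]"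
    by auto
  have IH: "length g = t" "\<forall>i<t. fst (g ! i) \<in> states M (Suc i) \<and>
      snd (g ! i) \<in> available M (Suc i) (fst (g ! i))"
    using Suc.IH[OF _ g] Suc.prems(1) by auto
  have sS: "s \<in> states M (Suc t)"
  proof (cases t)
    case 0
    then show ?thesis using s assms(3) by simp
  next
    case (Suc u)
    then have l: "last g = g ! u" using IH(1) last_conv_nth[of g] by fastforce
    have "fst (g ! u) \<in> states M t" "snd (g ! u) \<in> actions M t"
      using IH(2) Suc by (auto simp: available_def)
    moreover have "t \<in> {1..<horizon M}" using Suc Suc.prems(1) by auto
    ultimately have "set_pmf (P t (fst (g ! u)) (snd (g ! u))) \<subseteq> states M (Suc t)"
      using assms(2) unfolding kernels_def by (fastforce simp: PiE_iff)
    then show ?thesis using s l Suc by auto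
  qed
  have "\<pi> (Suc t) s \<in> {p. set_pmf p \<subseteq> available M (Suc t) s}"
    using assms(1) sS Suc.prems(1) unfolding policies_MR_def by (fastforce simp: PiE_iff)
  then have "a \<in> available M (Suc t) s" using a by auto
  then show ?case using IH sS h by (auto simp: nth_append less_Suc_eq)
qed

lemma history_law_cost_finite:
  assumes "valid_mdp M" "\<pi> \<in> policies_MR M" "P \<in> kernels M" "s1 \<in> states M 1"
  assumes "h \<in> set_pmf (history_law \<pi> P s1 (horizon M))" "t \<in> {1..horizon M}"
  shows "\<bar>cost M t (fst (h ! (t - 1))) (snd (h ! (t - 1)))\<bar> \<noteq> \<infinity>"
proof -
  have "fst (h ! (t - 1)) \<in> states M (Suc (t - 1)) \<and>
      snd (h ! (t - 1)) \<in> available M (Suc (t - 1)) (fst (h ! (t - 1)))"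
    using history_law_available[OF assms(2-4) order_refl assms(5)] assms(6)
    by (cases t) auto
  then show ?thesis
    using assms(1,6) by (auto simp: valid_mdp_def available_def)
qed

end

theory Submission
  imports Defs
begin

text \<open>
  Three stages, with deterministic transitions and costs incurred only in the final state,
  where the cost is the number of the state. The only choices are the probabilities \<open>x\<close>
  of action 1 in the initial state and \<open>y\<close> of action 1 in state 0 at stage 2. The first
  kernel leads to state 0 after action 0 and the second one after action 1, and the final
  states are arranged such that the values are \<open>V1 = (1 - x) (1 + y)\<close> and
  \<open>V2 = 1 + x (1 - 2 y)\<close>. Both equal 1 at \<open>x = y = 0\<close>. Nearby, \<open>V2 > 1\<close> if
  \<open>x > 0\<close>, while \<open>V1 > 1\<close> if \<open>x = 0 < y\<close>. But both vanish at \<open>x = y = 1\<close>.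
\<close>

definition ex_mdp :: "(nat, nat) mdp" where
  "ex_mdp = \<lparr>horizon = 3,
     states = (\<lambda>t. if t = 1 then {0} else if t = 2 then {0, 1} else {0, 1, 2}),
     actions = (\<lambda>t. {0, 1}),
     cost = (\<lambda>t s a. if a = 0 \<or> t < 3 \<and> s = 0
                       then ereal (if t = 3 then real s else 0) else \<infinity>)\<rparr>"

text \<open>The restrictions provide the extensionality that membership in \<open>kernels\<close>
  demands. \<open>det_policy\<close> is restricted for the same reason.\<close>

definition det_kernel ::
  "('s, 'a) mdp \<Rightarrow> (nat \<Rightarrow> 's \<Rightarrow> 'a \<Rightarrow> 's) \<Rightarrow> nat \<Rightarrow> 's \<Rightarrow> 'a \<Rightarrow> 's pmf" where
  "det_kernel M f = (\<lambda>t\<in>{1..<horizon M}. \<lambda>s\<in>states M t. \<lambda>a\<in>actions M t. return_pmf (f t s a))"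

definition det_policy :: "('s, 'a) mdp \<Rightarrow> (nat \<Rightarrow> 's \<Rightarrow> 'a) \<Rightarrow> nat \<Rightarrow> 's \<Rightarrow> 'a pmf" where
  "det_policy M g = (\<lambda>t\<in>{1..horizon M}. \<lambda>s\<in>states M t. return_pmf (g t s))"

text \<open>At stage 2, state 0 is entered with probability \<open>1 - x\<close> and has expected
  final cost \<open>1 + y\<close>, whereas state 1 costs nothing.\<close>

definition next1 :: "nat \<Rightarrow> nat \<Rightarrow> nat \<Rightarrow> nat" where
  "next1 t s a = (if t = 1 then a else if s = 0 then 1 + a else 0)"

text \<open>Here state 0 is entered with probability \<open>x\<close> and has expected final cost
  \<open>2 * (1 - y)\<close>, whereas state 1 costs 1. So action 1 in state 0 is now the good one.
  The subtractions on \<open>nat\<close> are exact for \<open>a\<close> in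
  \<open>{0, 1}\<close>.\<close>

definition next2 :: "nat \<Rightarrow> nat \<Rightarrow> nat \<Rightarrow> nat" where
  "next2 t s a = (if t = 1 then 1 - a else if s = 0 then 2 - 2 * a else 1)"

lemma det_kernel_in_kernels:
  assumes "\<And>t s a. t \<in> {1..<horizon M} \<Longrightarrow> s \<in> states M t \<Longrightarrow> a \<in> actions M t
             \<Longrightarrow> f t s a \<in> states M (Suc t)"
  shows "det_kernel M f \<in> kernels M"
  unfolding det_kernel_def kernels_def using assms by (intro restrict_PiE_iff[THEN iffD2] ballI) auto

lemma det_policy_in_policies_MR:
  assumes "\<And>t s. t \<in> {1..horizon M} \<Longrightarrow> s \<in> states M t \<Longrightarrow> g t s \<in> available M t s"
  shows "det_policy M g \<in> policies_MR M"
  unfolding det_policy_def policies_MR_def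
  using assms by (intro restrict_PiE_iff[THEN iffD2] ballI) auto

lemma policies_MR_set_pmf:
  assumes "\<pi> \<in> policies_MR M" "t \<in> {1..horizon M}" "s \<in> states M t"
  shows "set_pmf (\<pi> t s) \<subseteq> available M t s"
  using PiE_mem[OF PiE_mem[OF assms(1)[unfolded policies_MR_def] assms(2)] assms(3)] by simp

lemma policies_MR_eqI:
  assumes "\<pi> \<in> policies_MR M" "\<pi>' \<in> policies_MR M"
  assumes "\<And>t s. t \<in> {1..horizon M} \<Longrightarrow> s \<in> states M t \<Longrightarrow> \<pi> t s = \<pi>' t s"
  shows "\<pi> = \<pi>'"
proof (rule PiE_ext[OF assms(1,2)[unfolded policies_MR_def]])
  fix t assume t: "t \<in> {1..horizon M}"
  show "\<pi> t = \<pi>' t"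
    by (rule PiE_ext[OF PiE_mem[OF assms(1)[unfolded policies_MR_def] t]
          PiE_mem[OF assms(2)[unfolded policies_MR_def] t]]) (rule assms(3)[OF t])
qed

text \<open>A coordinate is bounded by the Euclidean norm. Validity supplies finite state spaces, so
  that the real-valued suprema are upper bounds.\<close>

lemma pmf_diff_le_policy_dist:
  assumes "valid_mdp M" "t \<in> {1..horizon M}" "s \<in> states M t" "a \<in> actions M t"
  shows "\<bar>pmf (\<pi> t s) a - pmf (\<pi>' t s) a\<bar> \<le> policy_dist M \<pi>' \<pi>"
proof -
  let ?d = "\<lambda>t s. L2_set (\<lambda>a. pmf (\<pi> t s) a - pmf (\<pi>' t s) a) (actions M t)"
  have fin: "finite (states M t)" "finite (actions M t)"
    using assms(1,2) by (auto simp: valid_mdp_def)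
  have "\<bar>pmf (\<pi> t s) a - pmf (\<pi>' t s) a\<bar>
      = L2_set (\<lambda>a. pmf (\<pi> t s) a - pmf (\<pi>' t s) a) {a}"
    by simp
  also have "\<dots> \<le> ?d t s"
    unfolding L2_set_def using fin(2) assms(4) by (intro real_sqrt_le_mono sum_mono2) auto
  also have "\<dots> \<le> (SUP s\<in>states M t. ?d t s)"
    using fin(1) assms(3) by (intro cSUP_upper) auto
  also have "\<dots> \<le> policy_dist M \<pi>' \<pi>"
    unfolding policy_dist_def using assms(2) by (intro cSUP_upper) auto
  finally show ?thesis .
qed

text \<open>Eliminating \<open>pmf p 0\<close> makes the values polynomials in the probabilities of
  action 1.\<close>

lemma expectation_bind_binary:
  fixes p :: "nat pmf" and h :: "'b \<Rightarrow> real"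
  assumes "set_pmf p \<subseteq> {0, 1}" "\<And>a. a \<in> {0, 1} \<Longrightarrow> finite (set_pmf (f a))"
  shows "measure_pmf.expectation (bind_pmf p f) h
       = (1 - pmf p 1) * measure_pmf.expectation (f 0) h
         + pmf p 1 * measure_pmf.expectation (f 1) h"
proof -
  have "pmf p 0 + pmf p 1 = 1"
    using sum_pmf_eq_1[OF _ assms(1)] by simp
  then show ?thesis
    using pmf_expectation_bind[of "{0, 1}" f p h] assms by (simp add: eq_diff_eq[symmetric])
qed

lemma pmf_binary_eq_return:
  fixes p :: "nat pmf"
  assumes "set_pmf p \<subseteq> {0, 1}" "pmf p 1 = 0"
  shows "p = return_pmf 0"
  using assms by (subst set_pmf_subset_singleton[symmetric]) (auto simp: set_pmf_iff)

lemma valid_ex_mdp: "valid_mdp ex_mdp"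
  by (auto simp: valid_mdp_def ex_mdp_def available_def)

lemma ex_kernels:
  "det_kernel ex_mdp next1 \<in> kernels ex_mdp" "det_kernel ex_mdp next2 \<in> kernels ex_mdp"
  by (rule det_kernel_in_kernels;
      force simp: ex_mdp_def next1_def next2_def split: if_splits)+

lemma ex_kernels_distinct: "det_kernel ex_mdp next1 \<noteq> det_kernel ex_mdp next2"
proof
  assume "det_kernel ex_mdp next1 = det_kernel ex_mdp next2"
  then have "det_kernel ex_mdp next1 1 0 0 = det_kernel ex_mdp next2 1 0 0"
    by simp
  then show False
    by (simp add: det_kernel_def ex_mdp_def next1_def next2_def)
qed

text \<open>The infinite costs force action 0 wherever no choice is intended, so \<open>x\<close>
  and \<open>y\<close> determine a policy. A further choice without effect on the values would
  destroy strictness of the minimum.\<close>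

lemma ex_policies:
  assumes "\<pi> \<in> policies_MR ex_mdp"
  shows "set_pmf (\<pi> 1 0) \<subseteq> {0, 1}" "set_pmf (\<pi> 2 0) \<subseteq> {0, 1}" "\<pi> 2 1 = return_pmf 0"
    "s \<in> {0, 1, 2} \<Longrightarrow> \<pi> 3 s = return_pmf 0"
proof -
  have "available ex_mdp 1 0 = {0, 1}" "available ex_mdp 2 0 = {0, 1}"
    "available ex_mdp 2 1 = {0}" "available ex_mdp 3 s = {0}" for s
    by (auto simp: ex_mdp_def available_def)
  then show "set_pmf (\<pi> 1 0) \<subseteq> {0, 1}" "set_pmf (\<pi> 2 0) \<subseteq> {0, 1}" "\<pi> 2 1 = return_pmf 0"
    "s \<in> {0, 1, 2} \<Longrightarrow> \<pi> 3 s = return_pmf 0"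
    using policies_MR_set_pmf[OF assms, of 1 0] policies_MR_set_pmf[OF assms, of 2 0]
      policies_MR_set_pmf[OF assms, of 2 1] policies_MR_set_pmf[OF assms, of 3 s]
    by (simp_all add: ex_mdp_def set_pmf_subset_singleton)
qed

text \<open>Backward evaluation: \<open>v s\<close> is the expected final cost from state
  \<open>s\<close> at stage 2. The map \<open>f\<close> is left general to serve both
  kernels.\<close>

lemma ex_policy_value:
  assumes "\<pi> \<in> policies_MR ex_mdp"
    and f: "f 1 0 0 \<in> {0, 1}" "f 1 0 1 \<in> {0, 1}"
      "\<And>s a. s \<in> {0, 1} \<Longrightarrow> a \<in> {0, 1} \<Longrightarrow> f 2 s a \<in> {0, 1, 2}"
  defines "x \<equiv> pmf (\<pi> 1 0) 1" and "y \<equiv> pmf (\<pi> 2 0) 1"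
  defines "v \<equiv> \<lambda>s. if s = 0 then (1 - y) * real (f 2 0 0) + y * real (f 2 0 1)
                  else real (f 2 1 0)"
  shows "policy_value ex_mdp (det_kernel ex_mdp f) \<pi> 0 = (1 - x) * v (f 1 0 0) + x * v (f 1 0 1)"
proof -
  note pol = ex_policies[OF assms(1)]
  let ?P = "det_kernel ex_mdp f"
  let ?C = "\<lambda>h :: (nat \<times> nat) list. \<Sum>t = 1..3. real_of_ereal
              (cost ex_mdp t (fst (h ! (t - 1))) (snd (h ! (t - 1))))"
  \<comment> \<open>\<open>H a\<close> is the law of the history after first action
    \<open>a\<close>, and \<open>K a s b\<close> its law once stage 2 is also fixed.\<close>
  define K where "K a s b = bind_pmf (?P 2 s b) (\<lambda>s'. bind_pmf (\<pi> 3 s')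
      (\<lambda>c. return_pmf [(0, a), (s, b), (s', c)]))" for a s b :: nat
  define H where "H a = bind_pmf (?P 1 0 a) (\<lambda>s. bind_pmf (\<pi> 2 s) (K a s))" for a :: nat
  have K: "K a s b = return_pmf [(0, a), (s, b), (f 2 s b, 0)]"
    if "s \<in> {0, 1}" "b \<in> {0, 1}" for a s b
  proof -
    have "?P 2 s b = return_pmf (f 2 s b)"
      using that by (auto simp: det_kernel_def ex_mdp_def)
    then show ?thesis
      using pol(4)[OF f(3)[OF that]] by (simp add: K_def bind_return_pmf)
  qed
  have C: "?C [(0, a), (s, b), (s', 0)] = real s'"
    if "a \<in> {0, 1}" "s = 0 \<or> b = 0" for a s b s'
    using that by (auto simp: numeral_3_eq_3 ex_mdp_def)
  \<comment> \<open>Finite support is carried along because \<open>expectation_bind_binary\<close>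
    needs it again at stage 1.\<close>
  have v: "measure_pmf.expectation (bind_pmf (\<pi> 2 s) (K a s)) ?C = v s
      \<and> finite (set_pmf (bind_pmf (\<pi> 2 s) (K a s)))"
    if "a \<in> {0, 1}" "s \<in> {0, 1}" for a s
  proof (cases "s = 0")
    case True
    have "measure_pmf.expectation (bind_pmf (\<pi> 2 0) (K a 0)) ?C
        = (1 - y) * measure_pmf.expectation (K a 0 0) ?C
          + y * measure_pmf.expectation (K a 0 1) ?C"
      unfolding y_def by (rule expectation_bind_binary[OF pol(2)]) (auto simp: K)
    also have "\<dots> = v 0"
      using C[OF that(1), of 0 0] C[OF that(1), of 0 1] by (simp add: K v_def)
    finally show ?thesis
      using True finite_subset[OF pol(2)] pol(2) by (auto simp: K)
  next
    case False
    then have s: "s = 1"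
      using that by simp
    show ?thesis
      using C[OF that(1), of 1 0] unfolding s pol(3) by (simp add: bind_return_pmf K v_def)
  qed
  have H: "measure_pmf.expectation (H a) ?C = v (f 1 0 a)" "finite (set_pmf (H a))"
    if "a \<in> {0, 1}" for a
  proof -
    have "?P 1 0 a = return_pmf (f 1 0 a)"
      using that by (auto simp: det_kernel_def ex_mdp_def)
    moreover have "f 1 0 a \<in> {0, 1}"
      using that f(1,2) by auto
    ultimately show "measure_pmf.expectation (H a) ?C = v (f 1 0 a)" "finite (set_pmf (H a))"
      using v[OF that] by (simp_all add: H_def bind_return_pmf)
  qed
  \<comment> \<open>\<open>history_law\<close> appends to the past; associativity of bind regroups
    it by the first action.\<close>
  have "history_law \<pi> ?P 0 3 = bind_pmf (\<pi> 1 0) H"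
    unfolding H_def K_def
    by (simp add: numeral_3_eq_3 numeral_2_eq_2 bind_assoc_pmf bind_return_pmf)
  moreover have "measure_pmf.expectation (bind_pmf (\<pi> 1 0) H) ?C
      = (1 - x) * measure_pmf.expectation (H 0) ?C + x * measure_pmf.expectation (H 1) ?C"
    unfolding x_def by (rule expectation_bind_binary[OF pol(1) H(2)])
  moreover have "horizon ex_mdp = 3"
    by (simp add: ex_mdp_def)
  ultimately show ?thesis
    by (simp only: policy_value_def H(1) insertI1 insertI2)
qed

lemma ex_robust_value:
  assumes "\<pi> \<in> policies_MR ex_mdp"
  defines "x \<equiv> pmf (\<pi> 1 0) 1" and "y \<equiv> pmf (\<pi> 2 0) 1"
  shows "robust_value ex_mdp (det_kernel ex_mdp next1) (det_kernel ex_mdp next2) \<pi> 0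
       = max ((1 - x) * (1 + y)) (1 + x * (1 - 2 * y))"
proof -
  have "policy_value ex_mdp (det_kernel ex_mdp next1) \<pi> 0 = (1 - x) * (1 + y)"
    by (subst ex_policy_value[OF assms(1)]) (auto simp: next1_def x_def y_def algebra_simps)
  moreover have "policy_value ex_mdp (det_kernel ex_mdp next2) \<pi> 0 = 1 + x * (1 - 2 * y)"
    by (subst ex_policy_value[OF assms(1)]) (auto simp: next2_def x_def y_def algebra_simps)
  ultimately show ?thesis
    by (simp add: robust_value_def)
qed

theorem theorem2p2:
  "\<exists>(M :: (nat, nat) mdp) s1 P1 P2.
     valid_mdp M \<and> s1 \<in> states M 1 \<and>
     P1 \<in> kernels M \<and> P2 \<in> kernels M \<and> P1 \<noteq> P2 \<and>
     (\<exists>\<pi>\<in>policies_MR M. \<exists>\<delta>>0. \<exists>\<pi>s\<in>policies_MR M.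
        robust_value M P1 P2 \<pi>s s1 < robust_value M P1 P2 \<pi> s1 \<and>
        (\<forall>\<pi>'\<in>policies_MR M. \<pi>' \<noteq> \<pi> \<and> policy_dist M \<pi>' \<pi> \<le> \<delta> \<longrightarrow>
           robust_value M P1 P2 \<pi> s1 < robust_value M P1 P2 \<pi>' s1))"
proof -
  let ?\<pi> = "det_policy ex_mdp (\<lambda>t s. 0)"
  \<comment> \<open>This is \<open>x = y = 1\<close>: action 1 is taken exactly where it is
    available.\<close>
  let ?\<pi>s = "det_policy ex_mdp (\<lambda>t s. if t < 3 \<and> s = 0 then 1 else 0)"
  let ?V = "robust_value ex_mdp (det_kernel ex_mdp next1) (det_kernel ex_mdp next2)"
  have pol: "?\<pi> \<in> policies_MR ex_mdp" "?\<pi>s \<in> policies_MR ex_mdp"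
    by (rule det_policy_in_policies_MR; simp add: ex_mdp_def available_def)+
  have V\<pi>: "?V ?\<pi> 0 = 1"
    using ex_robust_value[OF pol(1)] by (simp add: det_policy_def ex_mdp_def)
  have V\<pi>s: "?V ?\<pi>s 0 = 0"
    using ex_robust_value[OF pol(2)] by (simp add: det_policy_def ex_mdp_def)
  \<comment> \<open>Any radius below 1/2 would do: it keeps the factor \<open>1 - 2 * y\<close> of
    the second value positive.\<close>
  have local: "1 < ?V \<pi>' 0"
    if \<pi>': "\<pi>' \<in> policies_MR ex_mdp" "\<pi>' \<noteq> ?\<pi>" "policy_dist ex_mdp \<pi>' ?\<pi> \<le> 1 / 4" for \<pi>'
  proof -
    define x y where "x = pmf (\<pi>' 1 0) 1" and "y = pmf (\<pi>' 2 0) 1"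
    have V: "?V \<pi>' 0 = max ((1 - x) * (1 + y)) (1 + x * (1 - 2 * y))"
      unfolding x_def y_def by (rule ex_robust_value[OF \<pi>'(1)])
    have nonneg: "x \<ge> 0" "y \<ge> 0"
      by (simp_all add: x_def y_def)
    \<comment> \<open>Since \<open>?\<pi>\<close> gives action 1 probability 0 in state 0 at stage
      2, the difference of the two probabilities there is \<open>y\<close> up to sign.\<close>
    have "y \<le> 1 / 4"
      using pmf_diff_le_policy_dist[OF valid_ex_mdp, of 2 0 1 ?\<pi> \<pi>'] \<pi>'(3)
      by (simp add: y_def det_policy_def ex_mdp_def)
    show ?thesis
    proof (cases "x > 0")
      case True
      then have "x * (1 - 2 * y) > 0"
        using \<open>y \<le> 1 / 4\<close> by simp
      then show ?thesis
        using V by simp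
    next
      case False
      then have x: "x = 0"
        using nonneg by simp
      \<comment> \<open>With \<open>x = 0\<close> the first value is \<open>1 + y\<close>, so only
        \<open>y = 0\<close> must be excluded; it would make all decisions of \<open>\<pi>'\<close>
        those of \<open>?\<pi>\<close>.\<close>
      have "y \<noteq> 0"
      proof
        assume y: "y = 0"
        have "\<pi>' 1 0 = return_pmf 0" "\<pi>' 2 0 = return_pmf 0"
          using pmf_binary_eq_return[OF ex_policies(1)[OF \<pi>'(1)]]
            pmf_binary_eq_return[OF ex_policies(2)[OF \<pi>'(1)]] x y
          unfolding x_def y_def by blast+
        then have "\<pi>' t s = ?\<pi> t s" if "t \<in> {1..horizon ex_mdp}" "s \<in> states ex_mdp t" for t s
        proof -
          have "t = 1 \<or> t = 2 \<or> t = 3"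
            using that(1) by (auto simp: ex_mdp_def)
          then consider "t = 1" "s = 0" | "t = 2" "s = 0" | "t = 2" "s = 1"
            | "t = 3" "s \<in> {0, 1, 2}"
            using \<open>s \<in> states ex_mdp t\<close> by (auto simp: ex_mdp_def)
          then have "\<pi>' t s = return_pmf 0"
          proof cases
            case 4
            then show ?thesis
              using ex_policies(4)[OF \<pi>'(1)] by blast
          qed (use \<open>\<pi>' 1 0 = _\<close> \<open>\<pi>' 2 0 = _\<close> ex_policies(3)[OF \<pi>'(1)] in blast)+
          then show ?thesis
            using that by (simp add: det_policy_def)
        qed
        then have "\<pi>' = ?\<pi>"
          by (rule policies_MR_eqI[OF \<pi>'(1) pol(1)])
        then show False
          using \<pi>'(2) by simp
      qed
      then show ?thesis
        using V x nonneg by simp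
    qed
  qed
  have "0 \<in> states ex_mdp 1" "(0::real) < 1 / 4" "?V ?\<pi>s 0 < ?V ?\<pi> 0"
    using V\<pi> V\<pi>s by (simp_all add: ex_mdp_def)
  then show ?thesis
    using valid_ex_mdp ex_kernels ex_kernels_distinct pol local unfolding V\<pi>[symmetric] by blast
qed

end
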